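(* Let $\beta\in\mathbb{C}^+$, $\varepsilon>0$, $k\in\mathbb{N}$. Let $D\subseteq\mathbb{C}^+$ be an admissible domain of type $(\beta,\varepsilon,k)$. For $C>\exp^{\circ k}(0)$, let $f:D_C\to\mathbb{C}$ be an analytic map such that $$f(\zeta)=\zeta+\beta+o\big(\zeta^{-1}\boldsymbol{L}_1^{-1}\cdots\boldsymbol{L}_k^{-(1+\varepsilon)}\big),\quad\text{as }\Re(\zeta)\to+\infty\text{ uniformly on }D_C.$$ Then: (i) (Existence) For a sufficiently large $R>\exp^{\circ k}(0)$ there exists an analytic linearizing map $\varphi$ on the $f$-invariant subdomain $D^f_R\subseteq D$, that is, $\varphi$ satisfies $$(\varphi\circ f)(\zeta)=\varphi(\zeta)+\beta\quad\text{for all }\zeta\in D^f_R.$$ Moreover, $\varphi$ is the uniform limit on $D^f_R$ of the Koenigs sequence $(f^{\circ n}-n\beta)_n$. (ii) If $D^f_R\cap\{\zeta\in\mathbb{C}^+:\Im(\zeta)=0\}$ is $f$-invariant, then it is also $\varphi$-invariant. (iii) (Asymptotics) The linearization $\varphi$ is tangent to the identity, i.e. $\varphi(\zeta)=\zeta+o(1)$ uniformly on $D^f_R\subseteq\mathbb{C}^+$ as $\Re(\zeta)\to+\infty$. In particular, $\varphi(\zeta)=\zeta+o(\boldsymbol{L}_k^{-\nu})$ for every $\nu\in(0,\varepsilon)$, uniformly as $\Re(\zeta)\to+\infty$, on every subdomain $D_{h_l,h_u}\subseteq D^f_R$ such that $h_l(x)=O(x)$ and $h_u(x)=O(x)$ as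 $x\to+\infty$. (iv) (Uniqueness) Let $\psi:D_1\to\mathbb{C}$ be a linearization of $f$ (an analytic map with $\psi\circ f=\psi+\beta$) on an $f$-invariant subset $D_1\subseteq D$, such that $\psi(\zeta)=\zeta+o(1)$ uniformly on $D_1$ as $\Re(\zeta)\to+\infty$. Then $\psi\equiv\varphi$ on $(D_1)_R$.
   Context: $\mathbb{C}^+:=\{\zeta\in\mathbb{C}:\Re(\zeta)>0\}$; $\mathbb{N}$ includes $0$. $\exp^{\circ k}$, $\log^{\circ k}$, $f^{\circ n}$ denote iterates (the $0$-th iterate is the identity). $\boldsymbol{L}_0:=\zeta$, $\boldsymbol{L}_1:=\log\zeta$, $\boldsymbol{L}_j:=\log\boldsymbol{L}_{j-1}$, with the principal branch of the logarithm; for $k=0$ the expression $\zeta^{-1}\boldsymbol{L}_1^{-1}\cdots\boldsymbol{L}_k^{-(1+\varepsilon)}$ means $\zeta^{-(1+\varepsilon)}$. For $D\subseteq\mathbb{C}$ and $R>0$, $D_R:=D\cap([R,+\infty)\times\mathbb{R})$ (points of $D$ with real part $\ge R$). For a map $g$, a set $S$ contained in the domain of $g$ is $g$-invariant if $g(S)\subseteq S$. $D^f$ is the maximal $f$-invariant subdomain of $D$ (union of all $f$-invariant subdomains of $D$), and $D^f_R:=(D^f)_R$; here a subdomain just means a subset. Analytic on a set that is not open means: continuous on the set and holomorphic in its interior. For $x>\exp^{\circ k}(0)$ let $$M_{\varepsilon,k}(x):=\frac{1}{x\log x\cdots(\log^{\circ k}x)^{1+\varepsilon}}\ \ (=x^{-(1+\varepsilon)}\text{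 if }k=0),\qquad \rho^{\pm}_{\beta,\varepsilon,k}(x):=\Re(\beta)\pm M_{\varepsilon,k}(x).$$ Write $M=M_{\varepsilon,k}$, $\rho^\pm=\rho^\pm_{\beta,\varepsilon,k}$. A lower-upper pair of type $(\beta,\varepsilon,k)$ is a pair of functions $h_l,h_u:[t,+\infty)\to\mathbb{R}$ with $h_l<h_u$ on $[t,+\infty)$, where $t>\exp^{\circ k}(0)$ and the following hold, all inequalities being for all $x\in[t,+\infty)$: (Case $\Im\beta>0$) $\rho^-(x)>0$ and $\Im(\beta)-M(x)>0$; $h_l$ is decreasing, or $h_l$ is increasing with $h_l(x+\rho^+(x))-h_l(x)\le\Im(\beta)-M(x)$; $h_u$ is increasing with $h_u(x+\rho^-(x))-h_u(x)\ge\Im(\beta)+M(x)$. (Case $\Im\beta=0$) $\rho^-(x)>0$; $h_l$ is decreasing with $h_l(x+\rho^-(x))-h_l(x)\le-M(x)$; $h_u$ is increasing with $h_u(x+\rho^-(x))-h_u(x)\ge M(x)$. (Case $\Im\beta<0$) $\rho^-(x)>0$ and $-\Im(\beta)-M(x)>0$; $h_l$ is decreasing with $h_l(x+\rho^-(x))-h_l(x)\le\Im(\beta)-M(x)$; $h_u$ is increasing, or $h_u$ is decreasing with $h_u(x+\rho^+(x))-h_u(x)\ge\Im(\beta)+M(x)$. For such a pair, $D_{h_l,h_u}:=\{\zeta\in\mathbb{C}^+:\Re\zeta\ge t,\ h_l(\Re\zeta)<\Im\zeta<h_u(\Re\zeta)\}$. A domain of type $(\beta,\varepsilon,k)$ is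 a union of a nonempty collection of sets $D_{h_l,h_u}$ of this form. An admissible domain of type $(\beta,\varepsilon,k)$ is a subset of $\mathbb{C}$ containing a domain of type $(\beta,\varepsilon,k)$.
   Formalization: In (ii), φ-invariance of the real part of D^f_R is replaced by: φ maps it into the positive real axis; literal invariance fails, e.g. for f(ζ)=ζ+1−ζ^{-3}, β=ε=1, k=0, D=ℂ⁺, C=2, where φ(R)<R for every R≥2. *)

theory Defs
  imports
    "HOL-Analysis.Analysis"
    "HOL-Library.Landau_Symbols"
    "HOL-Library.Going_To_Filter"
begin

definition right_half_plane :: "complex set"
  where "right_half_plane = {\<zeta>. 0 < Re \<zeta>}"

definition positive_axis :: "complex set"
  where "positive_axis = {\<zeta> \<in> right_half_plane. Im \<zeta> = 0}"

definition Re_ge_part :: "complex set \<Rightarrow> real \<Rightarrow> complex set"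
  where "Re_ge_part D R = {\<zeta> \<in> D. R \<le> Re \<zeta>}"

definition iter_exp0 :: "nat \<Rightarrow> real"
  where "iter_exp0 k = (exp ^^ k) 0"

definition iter_log :: "nat \<Rightarrow> complex \<Rightarrow> complex"
  where "iter_log j \<zeta> = (Ln ^^ j) \<zeta>"

text \<open>
  The scale \<open>1 / (x log x \<dots> (log\<^sup>k x)\<^sup>1\<^sup>+\<^sup>\<epsilon>)\<close> and its complex counterpart. Only the last factor
  carries the exponent \<open>1 + \<epsilon>\<close>; for \<open>k = 0\<close> the product is empty and the last factor
  is the variable itself.
\<close>

definition log_scale :: "real \<Rightarrow> nat \<Rightarrow> real \<Rightarrow> real"
  where "log_scale \<epsilon> k x =
    1 / ((\<Prod>j<k. (ln ^^ j) x) * ((ln ^^ k) x) powr (1 + \<epsilon>))"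

definition clog_scale :: "real \<Rightarrow> nat \<Rightarrow> complex \<Rightarrow> complex"
  where "clog_scale \<epsilon> k \<zeta> =
    (\<Prod>j<k. inverse (iter_log j \<zeta>)) * iter_log k \<zeta> powr (- complex_of_real (1 + \<epsilon>))"

definition rho_plus :: "complex \<Rightarrow> real \<Rightarrow> nat \<Rightarrow> real \<Rightarrow> real"
  where "rho_plus \<beta> \<epsilon> k x = Re \<beta> + log_scale \<epsilon> k x"

definition rho_minus :: "complex \<Rightarrow> real \<Rightarrow> nat \<Rightarrow> real \<Rightarrow> real"
  where "rho_minus \<beta> \<epsilon> k x = Re \<beta> - log_scale \<epsilon> k x"

text \<open>
  Functions on \<open>[t, \<infinity>)\<close> are represented by total functions whose values below \<open>t\<close> are irrelevant.
  Monotonicity is understood in the weak sense, so that constant functions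
  count both as increasing and as decreasing; this gives the larger class of pairs.
\<close>

definition lower_upper_pair ::
    "complex \<Rightarrow> real \<Rightarrow> nat \<Rightarrow> real \<Rightarrow> (real \<Rightarrow> real) \<Rightarrow> (real \<Rightarrow> real) \<Rightarrow> bool"
  where "lower_upper_pair \<beta> \<epsilon> k t hl hu \<longleftrightarrow>
    iter_exp0 k < t \<and>
    (\<forall>x\<ge>t. hl x < hu x) \<and>
    (\<forall>x\<ge>t. 0 < rho_minus \<beta> \<epsilon> k x) \<and>
    (0 < Im \<beta> \<longrightarrow>
      (\<forall>x\<ge>t. 0 < Im \<beta> - log_scale \<epsilon> k x) \<and>
      (antimono_on {t..} hl \<or>
       mono_on {t..} hl \<and>
       (\<forall>x\<ge>t. hl (x + rho_plus \<beta> \<epsilon> k x) - hl x \<le> Im \<beta> - log_scale \<epsilon> k x)) \<and>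
      mono_on {t..} hu \<and>
      (\<forall>x\<ge>t. hu (x + rho_minus \<beta> \<epsilon> k x) - hu x \<ge> Im \<beta> + log_scale \<epsilon> k x)) \<and>
    (Im \<beta> = 0 \<longrightarrow>
      antimono_on {t..} hl \<and>
      (\<forall>x\<ge>t. hl (x + rho_minus \<beta> \<epsilon> k x) - hl x \<le> - log_scale \<epsilon> k x) \<and>
      mono_on {t..} hu \<and>
      (\<forall>x\<ge>t. hu (x + rho_minus \<beta> \<epsilon> k x) - hu x \<ge> log_scale \<epsilon> k x)) \<and>
    (Im \<beta> < 0 \<longrightarrow>
      (\<forall>x\<ge>t. 0 < - Im \<beta> - log_scale \<epsilon> k x) \<and>
      antimono_on {t..} hl \<and>
      (\<forall>x\<ge>t. hl (x + rho_minus \<beta> \<epsilon> k x) - hl x \<le> Im \<beta> - log_scale \<epsilon> k x) \<and>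
      (mono_on {t..} hu \<or>
       antimono_on {t..} hu \<and>
       (\<forall>x\<ge>t. hu (x + rho_plus \<beta> \<epsilon> k x) - hu x \<ge> Im \<beta> + log_scale \<epsilon> k x)))"

definition strip_domain :: "real \<Rightarrow> (real \<Rightarrow> real) \<Rightarrow> (real \<Rightarrow> real) \<Rightarrow> complex set"
  where "strip_domain t hl hu =
    {\<zeta> \<in> right_half_plane. t \<le> Re \<zeta> \<and> hl (Re \<zeta>) < Im \<zeta> \<and> Im \<zeta> < hu (Re \<zeta>)}"

definition domain_of_type :: "complex \<Rightarrow> real \<Rightarrow> nat \<Rightarrow> complex set \<Rightarrow> bool"
  where "domain_of_type \<beta> \<epsilon> k D \<longleftrightarrow>
    (\<exists>\<D>. \<D> \<noteq> {} \<and>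
      (\<forall>U\<in>\<D>. \<exists>t hl hu. lower_upper_pair \<beta> \<epsilon> k t hl hu \<and> U = strip_domain t hl hu) \<and>
      D = \<Union>\<D>)"

definition admissible_domain :: "complex \<Rightarrow> real \<Rightarrow> nat \<Rightarrow> complex set \<Rightarrow> bool"
  where "admissible_domain \<beta> \<epsilon> k D \<longleftrightarrow> (\<exists>U. domain_of_type \<beta> \<epsilon> k U \<and> U \<subseteq> D)"

text \<open>
  A map with domain \<open>E\<close> is a total function together with \<open>E\<close>; an invariant set has to lie in
  the domain \<open>E\<close> of the map.
\<close>

definition invariant_set :: "(complex \<Rightarrow> complex) \<Rightarrow> complex set \<Rightarrow> complex set \<Rightarrow> bool"
  where "invariant_set f E S \<longleftrightarrow> S \<subseteq> E \<and> f ` S \<subseteq> S"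

definition max_invariant ::
    "(complex \<Rightarrow> complex) \<Rightarrow> complex set \<Rightarrow> complex set \<Rightarrow> complex set"
  where "max_invariant f E D = \<Union>{S. S \<subseteq> D \<and> invariant_set f E S}"

text \<open>
  The library's \<^const>\<open>analytic_on\<close> demands holomorphy on a neighbourhood of the set;
  on sets that need not be open the following weaker notion is used instead.
\<close>

definition analytic_map_on :: "complex set \<Rightarrow> (complex \<Rightarrow> complex) \<Rightarrow> bool"
  where "analytic_map_on S g \<longleftrightarrow> continuous_on S g \<and> g holomorphic_on interior S"

definition linearization_on ::
    "(complex \<Rightarrow> complex) \<Rightarrow> complex \<Rightarrow> complex set \<Rightarrow> (complex \<Rightarrow> complex) \<Rightarrow> bool"
  where "linearization_on f \<beta> S \<phi> \<longleftrightarrow>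
    analytic_map_on S \<phi> \<and> (\<forall>\<zeta>\<in>S. (\<phi> \<circ> f) \<zeta> = \<phi> \<zeta> + \<beta>)"

text \<open>
  Uniform limits on \<open>S\<close> as the real part tends to infinity. Landau symbols with respect to
  this filter are the uniform ones.
\<close>

abbreviation Re_at_top_within :: "complex set \<Rightarrow> complex filter"
  where "Re_at_top_within S \<equiv> Re going_to at_top within S"

text \<open>
  Invariance of the real part \<open>A\<close> of a domain under a linearization \<open>\<phi>\<close> is understood relative to
  the positive real axis: \<open>\<phi>\<close> maps \<open>A\<close> into that axis. The inclusion \<open>\<phi> ` A \<subseteq> A\<close> fails
  in general, since \<open>\<phi>\<close> may move points across the left end of \<open>A\<close>: for
  \<open>f \<zeta> = \<zeta> + 1 - 1 / \<zeta>\<^sup>3\<close> on \<open>Re \<zeta> \<ge> 2\<close> (with \<open>\<beta> = 1\<close>, \<open>\<epsilon> = 1\<close>, \<open>k = 0\<close>) and \<open>A = [R, \<infinity>)\<close>, \<open>R \<ge> 2\<close>,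
  the limit \<open>\<phi> R = R - (\<Sum>n. 1 / ((f ^^ n) R)\<^sup>3)\<close> of the Koenigs sequence is smaller than \<open>R\<close>.
\<close>

definition maps_into_positive_axis :: "(complex \<Rightarrow> complex) \<Rightarrow> complex set \<Rightarrow> bool"
  where "maps_into_positive_axis \<phi> A \<longleftrightarrow> \<phi> ` A \<subseteq> positive_axis"

end

theory Submission
  imports Defs "HOL-Complex_Analysis.Conformal_Mappings"
begin

text \<open>
  The linearization is the limit of the Koenigs sequence \<open>f\<^sup>n - n \<beta>\<close>, which telescopes into
  \<open>\<zeta> + \<Sum>\<^sub>i g (f\<^sup>i \<zeta>)\<close> with \<open>g \<zeta> = f \<zeta> - \<zeta> - \<beta>\<close>. Everything follows from control of this series.
  For large \<open>Re \<zeta>\<close>, complex iterated logarithms are at least as large in modulus as the real ones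
  at \<open>Re \<zeta>\<close>, so \<open>\<bar>g \<zeta>\<bar> \<le> m (Re \<zeta>)\<close> far to the right, where \<open>m\<close> is the real scale (\<open>norm_clog_scale_le\<close>). In
  particular each step of an orbit increases the real part by at least \<open>b = Re \<beta> / 2\<close>, and as \<open>m\<close>
  is decreasing and is the derivative of \<open>- (log\<^sup>k x)\<^sup>-\<^sup>\<epsilon> / \<epsilon>\<close>, the series is dominated by
  \<open>\<Sum>\<^sub>i m (x + i b) \<le> A (log\<^sup>k x)\<^sup>-\<^sup>\<epsilon>\<close> with \<open>x = Re \<zeta>\<close> and a constant \<open>A\<close>
  (\<open>sum_log_scale_le\<close>).

  The Weierstrass test then gives uniform convergence, and the same bound gives
  \<open>\<bar>\<phi> \<zeta> - \<zeta>\<bar> \<le> A (log\<^sup>k Re \<zeta>)\<^sup>-\<^sup>\<epsilon>\<close>, hence tangency to the identity; in a sector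
  \<open>\<bar>L\<^sub>k\<bar>\<close> is at most a multiple of \<open>log\<^sup>k Re \<zeta>\<close>, which yields the finer asymptotics. Positivity of \<open>\<phi>\<close> on
  the real axis holds once the threshold exceeds \<open>A\<close>. A linearization tangent to the identity
  differs from the Koenigs sequence by \<open>o(1)\<close> along every orbit, whence uniqueness.

  The iterates are holomorphic in the interior of an invariant set although \<open>f\<close> may map interior
  points to boundary points: where that happens, \<open>f\<close> is locally constant
  (\<open>holomorphic_on_funpow_connected\<close>).
\<close>

section \<open>Iterated logarithms\<close>

text \<open>
  The numbers at which the first \<open>k\<close> iterated logarithms, and the number itself, are at least 1: an
  upward closed set containing a neighbourhood of infinity, on which all factors of the scale
  are increasing and none falls below 1.
\<close>

definition iter_ln_ge_1 :: "nat \<Rightarrow> real set"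
  where "iter_ln_ge_1 k = {x. \<forall>j\<le>k. 1 \<le> (ln ^^ j) x}"

lemma iter_ln_at_top: "filterlim ((ln :: real \<Rightarrow> real) ^^ j) at_top at_top"
proof (induction j)
  case 0
  show ?case by (simp add: id_def filterlim_ident)
next
  case (Suc j)
  show ?case
    using filterlim_compose[OF ln_at_top Suc] by (simp add: o_def)
qed

lemma eventually_iter_ln_ge_1: "eventually (\<lambda>x. x \<in> iter_ln_ge_1 k) at_top"
proof -
  have "eventually (\<lambda>x. \<forall>j\<in>{..k}. 1 \<le> (ln ^^ j) (x::real)) at_top"
    using iter_ln_at_top by (intro eventually_ball_finite) (auto simp: filterlim_at_top)
  then show ?thesis
    by (rule eventually_mono) (auto simp: iter_ln_ge_1_def)
qed

lemma iter_ln_mono: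
  assumes "x \<in> iter_ln_ge_1 k" "x \<le> y" "j \<le> k"
  shows "(ln ^^ j) x \<le> (ln ^^ j) y"
  using assms(3)
proof (induction j)
  case 0
  then show ?case using assms(2) by simp
next
  case (Suc j)
  then have "1 \<le> (ln ^^ j) x" "(ln ^^ j) x \<le> (ln ^^ j) y"
    using assms(1) by (auto simp: iter_ln_ge_1_def)
  then show ?case by simp
qed

lemma iter_ln_ge_1_upward: "x \<in> iter_ln_ge_1 k \<Longrightarrow> x \<le> y \<Longrightarrow> y \<in> iter_ln_ge_1 k"
  using iter_ln_mono[of x k y] unfolding iter_ln_ge_1_def by (auto intro: order_trans)

lemma iter_ln_has_derivative:
  assumes "x \<in> iter_ln_ge_1 k" "j \<le> k"
  shows "((ln ^^ j) has_real_derivative (1 / (\<Prod>i<j. (ln ^^ i) x))) (at x)"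
  using assms(2)
proof (induction j)
  case 0
  show ?case by (auto simp: id_def intro!: derivative_eq_intros)
next
  case (Suc j)
  have "1 \<le> (ln ^^ j) x" using Suc.prems assms(1) by (simp add: iter_ln_ge_1_def)
  then show ?case
    using Suc by (auto simp: o_def intro!: derivative_eq_intros)
qed

text \<open>The function \<open>(log\<^sup>k x)\<^sup>-\<^sup>\<epsilon>\<close> is, up to the factor \<open>-\<epsilon>\<close>, a primitive of the scale.\<close>

lemma powr_iter_ln_has_derivative:
  assumes "x \<in> iter_ln_ge_1 k"
  shows "((\<lambda>x. (ln ^^ k) x powr - \<epsilon>) has_real_derivative (- \<epsilon> * log_scale \<epsilon> k x)) (at x)"
proof -
  have "1 \<le> (ln ^^ k) x" using assms by (simp add: iter_ln_ge_1_def)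
  moreover have "(ln ^^ k) x powr (- \<epsilon> - 1) = 1 / (ln ^^ k) x powr (1 + \<epsilon>)"
    using powr_minus_divide[of "(ln ^^ k) x" "1 + \<epsilon>"]
    by (metis add.commute minus_add_distrib uminus_add_conv_diff)
  ultimately show ?thesis
    using iter_ln_has_derivative[OF assms order_refl]
    by (auto intro!: derivative_eq_intros simp: log_scale_def powr_diff powr_add divide_simps)
qed

lemma log_scale_denominator_mono:
  assumes "x \<in> iter_ln_ge_1 k" "x \<le> y" "0 < \<epsilon>"
  shows "(\<Prod>j<k. (ln ^^ j) x) * (ln ^^ k) x powr (1 + \<epsilon>)
           \<le> (\<Prod>j<k. (ln ^^ j) y) * (ln ^^ k) y powr (1 + \<epsilon>)"
proof -
  have ge: "1 \<le> (ln ^^ j) x" if "j \<le> k" for j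
    using that assms(1) by (simp add: iter_ln_ge_1_def)
  have "(\<Prod>j<k. (ln ^^ j) x) \<le> (\<Prod>j<k. (ln ^^ j) y)"
    using iter_ln_mono[OF assms(1,2)] ge by (intro prod_mono) (auto intro: order_trans[OF zero_le_one])
  moreover have "(ln ^^ k) x powr (1 + \<epsilon>) \<le> (ln ^^ k) y powr (1 + \<epsilon>)"
    using iter_ln_mono[OF assms(1,2) order_refl] ge[of k] assms(3) by (intro powr_mono2) auto
  moreover have "0 \<le> (\<Prod>j<k. (ln ^^ j) y)"
    using iter_ln_mono[OF assms(1,2)] ge
    by (intro prod_nonneg) (meson lessThan_iff less_imp_le order_trans zero_le_one)
  ultimately show ?thesis by (intro mult_mono) auto
qed

lemma log_scale_denominator_ge:
  assumes "x \<in> iter_ln_ge_1 k"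
  shows "(ln ^^ k) x powr (1 + \<epsilon>) \<le> (\<Prod>j<k. (ln ^^ j) x) * (ln ^^ k) x powr (1 + \<epsilon>)"
proof -
  have "1 \<le> (\<Prod>j<k. (ln ^^ j) x)"
    using assms by (intro prod_ge_1) (auto simp: iter_ln_ge_1_def)
  then show ?thesis by (simp add: mult_le_cancel_right1)
qed

lemma log_scale_pos:
  assumes "x \<in> iter_ln_ge_1 k"
  shows "0 < log_scale \<epsilon> k x"
proof -
  have "0 < (ln ^^ j) x" if "j \<le> k" for j
    using that assms by (force simp: iter_ln_ge_1_def)
  then show ?thesis
    unfolding log_scale_def
    by (intro divide_pos_pos mult_pos_pos prod_pos) (auto simp: less_imp_neq[THEN not_sym])
qed

lemma log_scale_antimono:
  assumes "x \<in> iter_ln_ge_1 k" "x \<le> y" "0 < \<epsilon>"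
  shows "log_scale \<epsilon> k y \<le> log_scale \<epsilon> k x"
proof -
  have "0 < (\<Prod>j<k. (ln ^^ j) x) * (ln ^^ k) x powr (1 + \<epsilon>)"
    using log_scale_pos[OF assms(1), of \<epsilon>] by (simp add: log_scale_def)
  then show ?thesis
    unfolding log_scale_def using log_scale_denominator_mono[OF assms]
    by (intro divide_left_mono) (auto intro!: mult_pos_pos)
qed

lemma log_scale_le_powr:
  assumes "x \<in> iter_ln_ge_1 k" "0 < \<epsilon>"
  shows "log_scale \<epsilon> k x \<le> (ln ^^ k) x powr - \<epsilon>"
proof -
  have ge: "1 \<le> (ln ^^ k) x" using assms(1) by (simp add: iter_ln_ge_1_def)
  have "log_scale \<epsilon> k x \<le> 1 / (ln ^^ k) x powr (1 + \<epsilon>)"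
    unfolding log_scale_def using ge log_scale_denominator_ge[OF assms(1), of \<epsilon>]
    by (intro divide_left_mono) (auto intro!: mult_pos_pos intro: less_le_trans[rotated])
  also have "\<dots> = (ln ^^ k) x powr - (1 + \<epsilon>)"
    by (rule powr_minus_divide[symmetric])
  also have "\<dots> \<le> (ln ^^ k) x powr - \<epsilon>"
    using ge by (intro powr_mono) auto
  finally show ?thesis .
qed

lemma log_scale_le_1:
  assumes "x \<in> iter_ln_ge_1 k" "0 < \<epsilon>"
  shows "log_scale \<epsilon> k x \<le> 1"
proof -
  have "(ln ^^ k) x powr - \<epsilon> \<le> (ln ^^ k) x powr 0"
    using assms by (intro powr_mono) (auto simp: iter_ln_ge_1_def)
  then show ?thesis
    using log_scale_le_powr[OF assms] assms(1)
    by (cases "(ln ^^ k) x = 0") auto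
qed

text \<open>
  An integral test with explicit constant: by the mean value theorem each term after the first
  is at most a difference of values of the primitive, and these differences telescope.
\<close>

lemma sum_log_scale_le:
  assumes "x \<in> iter_ln_ge_1 k" "0 < \<epsilon>" "0 < b"
  shows "(\<Sum>i<n. log_scale \<epsilon> k (x + real i * b)) \<le> (1 + 1 / (b * \<epsilon>)) * (ln ^^ k) x powr - \<epsilon>"
proof (cases n)
  case 0
  then show ?thesis using assms by simp
next
  case (Suc m)
  define P where "P = (\<lambda>y. (ln ^^ k) y powr - \<epsilon>)"
  have step: "b * \<epsilon> * log_scale \<epsilon> k (y + b) \<le> P y - P (y + b)" if "x \<le> y" for y
  proof -
    have reg: "z \<in> iter_ln_ge_1 k" if "y \<le> z" for z
      using iter_ln_ge_1_upward[OF assms(1)] that \<open>x \<le> y\<close> by simp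
    have "\<exists>z>y. z < y + b \<and> P (y + b) - P y = (y + b - y) * (- \<epsilon> * log_scale \<epsilon> k z)"
      using assms(3) powr_iter_ln_has_derivative[OF reg] unfolding P_def by (intro MVT2) auto
    then obtain z where z: "y < z" "z < y + b" "P y - P (y + b) = b * \<epsilon> * log_scale \<epsilon> k z"
      by (auto simp: algebra_simps)
    have "log_scale \<epsilon> k (y + b) \<le> log_scale \<epsilon> k z"
      using z reg assms(2) by (intro log_scale_antimono) auto
    then show ?thesis using z(3) assms(2,3) by simp
  qed
  have "b * \<epsilon> * (\<Sum>i<m. log_scale \<epsilon> k (x + real (Suc i) * b))
        = (\<Sum>i<m. b * \<epsilon> * log_scale \<epsilon> k ((x + real i * b) + b))"
    by (simp add: sum_distrib_left algebra_simps)
  also have "\<dots> \<le> (\<Sum>i<m. P (x + real i * b) - P (x + real (Suc i) * b))"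
  proof (rule sum_mono)
    fix i
    show "b * \<epsilon> * log_scale \<epsilon> k ((x + real i * b) + b)
            \<le> P (x + real i * b) - P (x + real (Suc i) * b)"
      using step[of "x + real i * b"] assms(3) by (simp add: algebra_simps)
  qed
  also have "\<dots> = P x - P (x + real m * b)"
    using sum_lessThan_telescope'[of "\<lambda>i. P (x + real i * b)" m] by simp
  also have "\<dots> \<le> P x" by (simp add: P_def)
  finally have "(\<Sum>i<m. log_scale \<epsilon> k (x + real (Suc i) * b)) \<le> P x / (b * \<epsilon>)"
    using assms(2,3) by (simp add: pos_le_divide_eq mult.commute)
  moreover have "log_scale \<epsilon> k x \<le> P x"
    unfolding P_def by (rule log_scale_le_powr[OF assms(1,2)])
  moreover have "(\<Sum>i<n. log_scale \<epsilon> k (x + real i * b))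
       = log_scale \<epsilon> k x + (\<Sum>i<m. log_scale \<epsilon> k (x + real (Suc i) * b))"
    unfolding Suc sum.lessThan_Suc_shift by simp
  ultimately show ?thesis by (simp add: P_def algebra_simps)
qed

lemma powr_iter_ln_tendsto_0:
  assumes "0 < \<delta>"
  shows "((\<lambda>x. (ln ^^ k) x powr - \<delta>) \<longlongrightarrow> (0::real)) at_top"
  using assms by (intro tendsto_neg_powr iter_ln_at_top) simp

text \<open>
  Since \<open>Re (Ln z) = ln \<bar>z\<bar> \<ge> ln (Re z)\<close>, the complex iterated logarithms dominate the real ones
  taken at the real part as long as the latter are at least 1, no matter how large the imaginary
  part is.
\<close>

lemma iter_ln_le_Re_iter_log:
  assumes "Re \<zeta> \<in> iter_ln_ge_1 k" "j \<le> k"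
  shows "(ln ^^ j) (Re \<zeta>) \<le> Re (iter_log j \<zeta>)"
  using assms(2)
proof (induction j)
  case 0
  show ?case by (simp add: iter_log_def)
next
  case (Suc j)
  have ge: "1 \<le> (ln ^^ j) (Re \<zeta>)" using Suc.prems assms(1) by (simp add: iter_ln_ge_1_def)
  have le: "(ln ^^ j) (Re \<zeta>) \<le> cmod (iter_log j \<zeta>)"
    using Suc complex_Re_le_cmod[of "iter_log j \<zeta>"] by simp
  then have "iter_log j \<zeta> \<noteq> 0" using ge by auto
  then have "Re (iter_log (Suc j) \<zeta>) = ln (cmod (iter_log j \<zeta>))"
    by (simp add: iter_log_def)
  then show ?case using ge le by (simp add: ln_mono)
qed

lemma norm_clog_scale_le:
  assumes "Re \<zeta> \<in> iter_ln_ge_1 k" "0 < \<epsilon>"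
  shows "cmod (clog_scale \<epsilon> k \<zeta>) \<le> log_scale \<epsilon> k (Re \<zeta>)"
proof -
  have ge: "1 \<le> (ln ^^ j) (Re \<zeta>)" if "j \<le> k" for j
    using that assms(1) by (simp add: iter_ln_ge_1_def)
  have le: "(ln ^^ j) (Re \<zeta>) \<le> cmod (iter_log j \<zeta>)" if "j \<le> k" for j
    using iter_ln_le_Re_iter_log[OF assms(1) that] complex_Re_le_cmod order_trans by blast
  have "cmod (clog_scale \<epsilon> k \<zeta>)
        = (\<Prod>j<k. inverse (cmod (iter_log j \<zeta>))) * cmod (iter_log k \<zeta>) powr - (1 + \<epsilon>)"
    by (simp add: clog_scale_def norm_mult prod_norm[symmetric] norm_inverse norm_powr_real_powr')
  also have "\<dots> \<le> (\<Prod>j<k. inverse ((ln ^^ j) (Re \<zeta>))) * (ln ^^ k) (Re \<zeta>) powr - (1 + \<epsilon>)"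
  proof (rule mult_mono)
    show "(\<Prod>j<k. inverse (cmod (iter_log j \<zeta>))) \<le> (\<Prod>j<k. inverse ((ln ^^ j) (Re \<zeta>)))"
    proof (rule prod_mono)
      fix j assume "j \<in> {..<k}"
      then show "0 \<le> inverse (cmod (iter_log j \<zeta>)) \<and>
          inverse (cmod (iter_log j \<zeta>)) \<le> inverse ((ln ^^ j) (Re \<zeta>))"
        using ge[of j] le[of j] by (auto intro!: le_imp_inverse_le)
    qed
    show "cmod (iter_log k \<zeta>) powr - (1 + \<epsilon>) \<le> (ln ^^ k) (Re \<zeta>) powr - (1 + \<epsilon>)"
      using ge[of k] le[of k] assms(2) by (intro powr_mono2') auto
    show "0 \<le> (\<Prod>j<k. inverse ((ln ^^ j) (Re \<zeta>)))"
      using ge by (intro prod_nonneg) (meson inverse_nonnegative_iff_nonnegative lessThan_iff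
        less_imp_le order_trans zero_le_one)
  qed simp
  also have "\<dots> = log_scale \<epsilon> k (Re \<zeta>)"
    unfolding log_scale_def powr_minus
    by (simp add: divide_inverse prod_inversef[unfolded o_def])
  finally show ?thesis .
qed

text \<open>
  Conversely, on a sector the two are comparable: the argument contributes at most \<open>pi\<close>.
\<close>

lemma norm_iter_log_le:
  assumes "0 < K"
  shows "\<exists>B>0. \<forall>\<zeta>. Re \<zeta> \<in> iter_ln_ge_1 k \<and> cmod \<zeta> \<le> K * Re \<zeta> \<longrightarrow>
            cmod (iter_log k \<zeta>) \<le> B * (ln ^^ k) (Re \<zeta>)"
proof (induction k)
  case 0
  show ?case using assms by (auto simp: iter_log_def)
next
  case (Suc k)
  then obtain B where B: "B > 0"
    "\<And>\<zeta>. Re \<zeta> \<in> iter_ln_ge_1 k \<Longrightarrow> cmod \<zeta> \<le> K * Re \<zeta> \<Longrightarrow>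
       cmod (iter_log k \<zeta>) \<le> B * (ln ^^ k) (Re \<zeta>)" by blast
  show ?case
  proof (intro exI[of _ "1 + \<bar>ln B\<bar> + pi"] conjI allI impI)
    show "0 < 1 + \<bar>ln B\<bar> + pi" using pi_gt_zero by linarith
    fix \<zeta> assume *: "Re \<zeta> \<in> iter_ln_ge_1 (Suc k) \<and> cmod \<zeta> \<le> K * Re \<zeta>"
    define l where "l = (ln ^^ k) (Re \<zeta>)"
    define w where "w = iter_log k \<zeta>"
    have reg: "Re \<zeta> \<in> iter_ln_ge_1 k" using * by (auto simp: iter_ln_ge_1_def)
    have "\<forall>j\<le>Suc k. 1 \<le> (ln ^^ j) (Re \<zeta>)" using * by (simp add: iter_ln_ge_1_def)
    from this[rule_format, of k] this[rule_format, of "Suc k"]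
    have l: "1 \<le> l" "1 \<le> ln l" by (auto simp: l_def)
    have "l \<le> cmod w"
      using iter_ln_le_Re_iter_log[OF reg order_refl] complex_Re_le_cmod[of w]
      by (simp add: l_def w_def)
    moreover have "cmod w \<le> B * l" unfolding l_def w_def using B(2) reg * by blast
    ultimately have w: "1 \<le> cmod w" "cmod w \<le> B * l" using l by auto
    have "cmod (Ln w) \<le> \<bar>Re (Ln w)\<bar> + \<bar>Im (Ln w)\<bar>" by (rule cmod_le)
    also have "\<bar>Im (Ln w)\<bar> \<le> pi"
      using w mpi_less_Im_Ln[of w] Im_Ln_le_pi[of w] by force
    also have "\<bar>Re (Ln w)\<bar> = ln (cmod w)"
      using w by (subst Re_Ln) auto
    also have "ln (cmod w) \<le> ln (B * l)"
      using w by (intro iffD2[OF ln_le_cancel_iff]) (auto intro: less_le_trans[OF zero_less_one])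
    also have "ln (B * l) = ln B + ln l"
      using B(1) l by (intro ln_mult_pos) auto
    also have "ln B + ln l + pi \<le> (1 + \<bar>ln B\<bar> + pi) * ln l"
    proof -
      have "\<bar>ln B\<bar> * 1 \<le> \<bar>ln B\<bar> * ln l" "pi * 1 \<le> pi * ln l"
        using l by (intro mult_left_mono; simp)+
      moreover have "ln B \<le> \<bar>ln B\<bar>" by simp
      ultimately have "ln B + ln l + pi \<le> ln l + \<bar>ln B\<bar> * ln l + pi * ln l" by linarith
      then show ?thesis by (simp add: algebra_simps)
    qed
    finally show "cmod (iter_log (Suc k) \<zeta>) \<le> (1 + \<bar>ln B\<bar> + pi) * (ln ^^ Suc k) (Re \<zeta>)"
      by (simp add: w_def l_def iter_log_def)
  qed
qed

section \<open>Koenigs sequences\<close>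

lemma funpow_maps_into:
  assumes "f ` S \<subseteq> S" "\<zeta> \<in> S"
  shows "(f ^^ n) \<zeta> \<in> S"
  using assms by (induction n) auto

lemma continuous_on_funpow:
  assumes "continuous_on S f" "f ` S \<subseteq> S"
  shows "continuous_on S (f ^^ n)"
proof (induction n)
  case 0
  show ?case by (simp add: id_def)
next
  case (Suc n)
  have "(f ^^ n) ` S \<subseteq> S" using funpow_maps_into[OF assms(2)] by blast
  then show ?case
    using continuous_on_compose[OF Suc continuous_on_subset[OF assms(1)]] by simp
qed

text \<open>
  An invariant set need not have an invariant interior. On a connected open subset, however,
  \<open>f\<close> is either constant, or open by the open mapping theorem; in the second case the image is
  again a connected open subset of the invariant set, and the induction can go on.
\<close>

lemma holomorphic_on_funpow_connected:
  assumes "f holomorphic_on interior S" "f ` S \<subseteq> S"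
    and "open U" "connected U" "U \<subseteq> S"
  shows "(f ^^ n) holomorphic_on U"
  using assms(3-5)
proof (induction n arbitrary: U)
  case 0
  show ?case by (simp add: id_def)
next
  case (Suc n)
  have hol: "f holomorphic_on U"
    using assms(1) Suc.prems by (meson holomorphic_on_subset interior_maximal)
  show ?case
  proof (cases "f constant_on U")
    case True
    then obtain c where "\<And>\<zeta>. \<zeta> \<in> U \<Longrightarrow> f \<zeta> = c" by (auto simp: constant_on_def)
    then have "(f ^^ Suc n) \<zeta> = (f ^^ n) c" if "\<zeta> \<in> U" for \<zeta>
      using that by (simp add: funpow_swap1)
    then show ?thesis
      by (subst holomorphic_cong[OF refl, where g = "\<lambda>_. (f ^^ n) c"]) auto
  next
    case False
    have "open (f ` U)"
      using open_mapping_thm[OF hol Suc.prems(1,2,1) order_refl False] .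
    moreover have "connected (f ` U)"
      using Suc.prems hol by (intro connected_continuous_image holomorphic_on_imp_continuous_on)
    moreover have "f ` U \<subseteq> S" using Suc.prems(3) assms(2) by blast
    ultimately have "(f ^^ n) holomorphic_on f ` U" by (rule Suc.IH)
    then show ?thesis
      unfolding funpow_Suc_right using hol by (rule holomorphic_on_compose[rotated])
  qed
qed

lemma holomorphic_on_funpow:
  assumes "f holomorphic_on interior S" "f ` S \<subseteq> S"
  shows "(f ^^ n) holomorphic_on interior S"
  unfolding holomorphic_on_def
proof
  fix \<zeta> assume "\<zeta> \<in> interior S"
  then obtain d where d: "0 < d" "ball \<zeta> d \<subseteq> interior S"
    using open_contains_ball[of "interior S"] by auto
  then have "(f ^^ n) holomorphic_on ball \<zeta> d"
    using interior_subset by (intro holomorphic_on_funpow_connected[OF assms]) auto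
  then have "(f ^^ n) field_differentiable at \<zeta>"
    using d(1) by (intro holomorphic_on_imp_differentiable_at) auto
  then show "(f ^^ n) field_differentiable at \<zeta> within interior S"
    by (rule field_differentiable_at_within)
qed

text \<open>
  The setting: on the invariant set \<open>S\<close> the map \<open>f\<close> is the translation by \<open>\<beta>\<close> up to an
  error \<open>m (Re \<zeta>)\<close> with \<open>m\<close> decreasing, it advances real parts by at least \<open>b\<close>, and \<open>G x\<close>
  bounds the accumulated errors along an orbit that starts at real part \<open>x\<close>.
\<close>

locale near_translation =
  fixes f :: "complex \<Rightarrow> complex" and \<beta> :: complex and S :: "complex set"
    and b R :: real and m G :: "real \<Rightarrow> real"
  assumes invariant: "f ` S \<subseteq> S"
    and Re_ge: "\<zeta> \<in> S \<Longrightarrow> R \<le> Re \<zeta>"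
    and b_pos: "0 < b"
    and advance: "\<zeta> \<in> S \<Longrightarrow> Re \<zeta> + b \<le> Re (f \<zeta>)"
    and deviation: "\<zeta> \<in> S \<Longrightarrow> cmod (f \<zeta> - (\<zeta> + \<beta>)) \<le> m (Re \<zeta>)"
    and m_nonneg: "R \<le> x \<Longrightarrow> 0 \<le> m x"
    and m_antimono: "R \<le> x \<Longrightarrow> x \<le> y \<Longrightarrow> m y \<le> m x"
    and sum_m_le: "R \<le> x \<Longrightarrow> (\<Sum>i<n. m (x + real i * b)) \<le> G x"
begin

text \<open>The Koenigs sequence of \<open>f\<close>: \<open>n\<close> steps of \<open>f\<close>, then \<open>n\<close> steps of the inverse translation.\<close>

definition koenigs :: "nat \<Rightarrow> complex \<Rightarrow> complex"
  where "koenigs n \<zeta> = (f ^^ n) \<zeta> - of_nat n * \<beta>"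

text \<open>The limit of the Koenigs sequence, written as a telescoping series.\<close>

definition koenigs_limit :: "complex \<Rightarrow> complex"
  where "koenigs_limit \<zeta> = \<zeta> + (\<Sum>i. f ((f ^^ i) \<zeta>) - ((f ^^ i) \<zeta> + \<beta>))"

lemma orbit_in: "\<zeta> \<in> S \<Longrightarrow> (f ^^ n) \<zeta> \<in> S"
  using funpow_maps_into[OF invariant] .

lemma Re_orbit_ge: "\<zeta> \<in> S \<Longrightarrow> Re \<zeta> + real n * b \<le> Re ((f ^^ n) \<zeta>)"
proof (induction n)
  case (Suc n)
  then show ?case using advance[OF orbit_in[OF Suc.prems, of n]] by (simp add: algebra_simps)
qed simp

lemma koenigs_eq: "koenigs n \<zeta> = \<zeta> + (\<Sum>i<n. f ((f ^^ i) \<zeta>) - ((f ^^ i) \<zeta> + \<beta>))"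
  by (induction n) (auto simp: koenigs_def algebra_simps)

lemma orbit_deviation:
  assumes "\<zeta> \<in> S"
  shows "cmod (f ((f ^^ i) \<zeta>) - ((f ^^ i) \<zeta> + \<beta>)) \<le> m (Re \<zeta> + real i * b)"
proof -
  have "R \<le> Re \<zeta> + real i * b" using Re_ge[OF assms] b_pos by (simp add: add_increasing2)
  then have "m (Re ((f ^^ i) \<zeta>)) \<le> m (Re \<zeta> + real i * b)"
    using Re_orbit_ge[OF assms] by (rule m_antimono)
  then show ?thesis using deviation[OF orbit_in[OF assms]] order_trans by blast
qed

lemma koenigs_uniform_limit: "uniform_limit S koenigs koenigs_limit sequentially"
proof -
  have "summable (\<lambda>i. m (R + real i * b))"
    using m_nonneg sum_m_le[of R] b_pos by (intro summableI_nonneg_bounded[where x = "G R"]) auto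
  moreover have "cmod (f ((f ^^ i) \<zeta>) - ((f ^^ i) \<zeta> + \<beta>)) \<le> m (R + real i * b)" if "\<zeta> \<in> S" for i \<zeta>
  proof -
    have "m (Re \<zeta> + real i * b) \<le> m (R + real i * b)"
      using Re_ge[OF that] b_pos by (intro m_antimono) auto
    then show ?thesis using orbit_deviation[OF that, of i] by linarith
  qed
  ultimately have "uniform_limit S (\<lambda>n \<zeta>. \<Sum>i<n. f ((f ^^ i) \<zeta>) - ((f ^^ i) \<zeta> + \<beta>))
      (\<lambda>\<zeta>. \<Sum>i. f ((f ^^ i) \<zeta>) - ((f ^^ i) \<zeta> + \<beta>)) sequentially"
    by (intro Weierstrass_m_test)
  then have "uniform_limit S (\<lambda>n \<zeta>. \<zeta> + (\<Sum>i<n. f ((f ^^ i) \<zeta>) - ((f ^^ i) \<zeta> + \<beta>)))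
      (\<lambda>\<zeta>. \<zeta> + (\<Sum>i. f ((f ^^ i) \<zeta>) - ((f ^^ i) \<zeta> + \<beta>))) sequentially"
    by (intro uniform_limit_add uniform_limit_const)
  then show ?thesis
    unfolding koenigs_limit_def koenigs_eq[symmetric] .
qed

lemma koenigs_tendsto: "\<zeta> \<in> S \<Longrightarrow> (\<lambda>n. koenigs n \<zeta>) \<longlonglongrightarrow> koenigs_limit \<zeta>"
  using tendsto_uniform_limitI[OF koenigs_uniform_limit] .

lemma koenigs_limit_near_id:
  assumes "\<zeta> \<in> S"
  shows "cmod (koenigs_limit \<zeta> - \<zeta>) \<le> G (Re \<zeta>)"
proof (rule LIMSEQ_le_const2)
  show "(\<lambda>n. cmod (koenigs n \<zeta> - \<zeta>)) \<longlonglongrightarrow> cmod (koenigs_limit \<zeta> - \<zeta>)"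
    using koenigs_tendsto[OF assms] by (intro tendsto_intros)
  have "cmod (koenigs n \<zeta> - \<zeta>) \<le> G (Re \<zeta>)" for n
  proof -
    have "cmod (koenigs n \<zeta> - \<zeta>) \<le> (\<Sum>i<n. m (Re \<zeta> + real i * b))"
      using orbit_deviation[OF assms] unfolding koenigs_eq by (simp add: sum_norm_le)
    also have "\<dots> \<le> G (Re \<zeta>)" by (rule sum_m_le[OF Re_ge[OF assms]])
    finally show ?thesis .
  qed
  then show "\<exists>N. \<forall>n\<ge>N. cmod (koenigs n \<zeta> - \<zeta>) \<le> G (Re \<zeta>)" by blast
qed

lemma koenigs_limit_linearizes:
  assumes "\<zeta> \<in> S"
  shows "koenigs_limit (f \<zeta>) = koenigs_limit \<zeta> + \<beta>"
proof (rule LIMSEQ_unique)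
  have "f \<zeta> \<in> S" using assms invariant by blast
  then show "(\<lambda>n. koenigs n (f \<zeta>)) \<longlonglongrightarrow> koenigs_limit (f \<zeta>)" by (rule koenigs_tendsto)
  have "koenigs n (f \<zeta>) = koenigs (Suc n) \<zeta> + \<beta>" for n
    by (simp add: koenigs_def funpow_swap1 algebra_simps)
  moreover have "(\<lambda>n. koenigs (Suc n) \<zeta> + \<beta>) \<longlonglongrightarrow> koenigs_limit \<zeta> + \<beta>"
    using LIMSEQ_Suc[OF koenigs_tendsto[OF assms]] by (intro tendsto_intros)
  ultimately show "(\<lambda>n. koenigs n (f \<zeta>)) \<longlonglongrightarrow> koenigs_limit \<zeta> + \<beta>" by simp
qed

lemma koenigs_limit_analytic:
  assumes "continuous_on S f" "f holomorphic_on interior S"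
  shows "analytic_map_on S koenigs_limit"
  unfolding analytic_map_on_def
proof
  have "continuous_on S (koenigs n)" for n
    unfolding koenigs_def
    by (intro continuous_intros continuous_on_funpow[OF assms(1) invariant])
  then show "continuous_on S koenigs_limit"
    by (intro uniform_limit_theorem[OF _ koenigs_uniform_limit]) auto
  show "koenigs_limit holomorphic_on interior S"
  proof (rule holomorphic_uniform_sequence)
    show "koenigs n holomorphic_on interior S" for n
      unfolding koenigs_def
      by (intro holomorphic_intros holomorphic_on_funpow[OF assms(2) invariant])
    fix \<zeta> assume "\<zeta> \<in> interior S"
    then obtain d where d: "0 < d" "cball \<zeta> d \<subseteq> interior S"
      using open_contains_cball[of "interior S"] by auto
    then have "uniform_limit (cball \<zeta> d) koenigs koenigs_limit sequentially"
      using koenigs_uniform_limit interior_subset by (blast intro: uniform_limit_on_subset)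
    with d show "\<exists>d>0. cball \<zeta> d \<subseteq> interior S \<and>
        uniform_limit (cball \<zeta> d) koenigs koenigs_limit sequentially" by blast
  qed simp
qed

text \<open>
  A linearization tangent to the identity is determined along orbits: its value at \<open>\<zeta>\<close> is
  \<open>\<psi> (f\<^sup>n \<zeta>) - n \<beta>\<close>, which differs from the Koenigs sequence by \<open>o(1)\<close>.
\<close>

lemma koenigs_limit_unique:
  assumes "\<zeta> \<in> S" "\<zeta> \<in> T" "f ` T \<subseteq> T"
    and lin: "\<And>z. z \<in> T \<Longrightarrow> \<psi> (f z) = \<psi> z + \<beta>"
    and tangent: "(\<lambda>z. \<psi> z - z) \<in> o[Re_at_top_within T](\<lambda>_. 1)"
  shows "\<psi> \<zeta> = koenigs_limit \<zeta>"
proof (rule LIMSEQ_unique[OF _ koenigs_tendsto[OF assms(1)]])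
  have T: "(f ^^ n) \<zeta> \<in> T" for n using funpow_maps_into[OF assms(3,2)] .
  have \<psi>: "\<psi> ((f ^^ n) \<zeta>) = \<psi> \<zeta> + of_nat n * \<beta>" for n
    using lin[OF T] by (induction n) (auto simp: algebra_simps)
  have "((\<lambda>z. \<psi> z - z) \<longlongrightarrow> 0) (Re_at_top_within T)"
    using smalloD_tendsto[OF tangent] by simp
  moreover have "filterlim (\<lambda>n. (f ^^ n) \<zeta>) (Re_at_top_within T) sequentially"
    unfolding going_to_within_def filterlim_inf filterlim_principal filterlim_filtercomap_iff o_def
  proof
    have "filterlim (\<lambda>n. Re \<zeta> + real n * b) at_top sequentially"
      using b_pos by (intro filterlim_tendsto_add_at_top[OF tendsto_const]
        filterlim_at_top_mult_tendsto_pos[OF tendsto_const] filterlim_real_sequentially)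
    then show "filterlim (\<lambda>n. Re ((f ^^ n) \<zeta>)) at_top sequentially"
      by (rule filterlim_at_top_mono) (use Re_orbit_ge[OF assms(1)] in simp)
  qed (use T in simp)
  ultimately have "(\<lambda>n. \<psi> ((f ^^ n) \<zeta>) - (f ^^ n) \<zeta>) \<longlonglongrightarrow> 0"
    by (rule filterlim_compose)
  then have "(\<lambda>n. \<psi> \<zeta> - (\<psi> ((f ^^ n) \<zeta>) - (f ^^ n) \<zeta>)) \<longlonglongrightarrow> \<psi> \<zeta> - 0"
    by (intro tendsto_intros)
  moreover have "\<psi> \<zeta> - (\<psi> ((f ^^ n) \<zeta>) - (f ^^ n) \<zeta>) = koenigs n \<zeta>" for n
    unfolding \<psi> koenigs_def by simp
  ultimately show "(\<lambda>n. koenigs n \<zeta>) \<longlonglongrightarrow> \<psi> \<zeta>" by simp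
qed

text \<open>
  If some orbit stays on the real axis, then \<open>\<beta>\<close> is real, because successive terms of the
  Koenigs sequence then differ by \<open>- Im \<beta>\<close> in their imaginary parts, and the sequence converges.
\<close>

lemma koenigs_limit_Im_zero:
  assumes "T \<subseteq> S" "f ` T \<subseteq> T" "\<And>z. z \<in> T \<Longrightarrow> Im z = 0" "\<zeta> \<in> T"
  shows "Im (koenigs_limit \<zeta>) = 0"
proof -
  have im: "Im (koenigs n \<zeta>) = - real n * Im \<beta>" for n
    using assms(3)[OF funpow_maps_into[OF assms(2,4), of n]] by (simp add: koenigs_def)
  have lim: "(\<lambda>n. Im (koenigs n \<zeta>)) \<longlonglongrightarrow> Im (koenigs_limit \<zeta>)"
    using koenigs_tendsto assms(1,4) by (intro tendsto_Im) blast
  have "(\<lambda>n. Im (koenigs (Suc n) \<zeta>) - Im (koenigs n \<zeta>)) \<longlonglongrightarrow> 0"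
    using tendsto_diff[OF LIMSEQ_Suc[OF lim] lim] by simp
  then have "Im \<beta> = 0"
    unfolding im by (simp add: algebra_simps LIMSEQ_const_iff)
  then show ?thesis using lim unfolding im by (simp add: LIMSEQ_const_iff)
qed

end

section \<open>Linearization on invariant domains\<close>

lemma max_invariant_invariant: "invariant_set f E (max_invariant f E D)"
  unfolding max_invariant_def invariant_set_def by blast

lemma invariant_subset_max_invariant:
  "D1 \<subseteq> D \<Longrightarrow> invariant_set f E D1 \<Longrightarrow> D1 \<subseteq> max_invariant f E D"
  unfolding max_invariant_def by blast

text \<open>
  From the estimate by \<open>(log\<^sup>k Re \<zeta>)\<^sup>-\<^sup>\<epsilon>\<close> to the one by \<open>\<bar>L\<^sub>k\<bar>\<^sup>-\<^sup>\<nu>\<close>: inside a sector the two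
  kinds of logarithm are comparable, and the spare exponent \<open>\<epsilon> - \<nu>\<close> absorbs the constants.
\<close>

lemma smallo_iter_log_powr:
  assumes bound: "\<And>\<zeta>. \<zeta> \<in> U \<Longrightarrow> cmod (h \<zeta>) \<le> A * (ln ^^ k) (Re \<zeta>) powr - \<epsilon>"
    and "\<nu> < \<epsilon>" "0 < \<nu>" "0 < K"
    and sector: "eventually (\<lambda>\<zeta>. cmod \<zeta> \<le> K * Re \<zeta>) (Re_at_top_within U)"
  shows "h \<in> o[Re_at_top_within U](\<lambda>\<zeta>. iter_log k \<zeta> powr (- complex_of_real \<nu>))"
proof (rule landau_o.smallI)
  fix c :: real assume "0 < c"
  obtain B where B: "B > 0"
    "\<And>\<zeta>. Re \<zeta> \<in> iter_ln_ge_1 k \<Longrightarrow> cmod \<zeta> \<le> K * Re \<zeta> \<Longrightarrow>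
       cmod (iter_log k \<zeta>) \<le> B * (ln ^^ k) (Re \<zeta>)"
    using norm_iter_log_le[OF assms(4)] by blast
  have "((\<lambda>x. A * (ln ^^ k) x powr - (\<epsilon> - \<nu>)) \<longlongrightarrow> A * 0) at_top"
    using assms(2) by (intro tendsto_mult tendsto_const powr_iter_ln_tendsto_0) simp
  moreover have "A * 0 < c * B powr - \<nu>" using \<open>0 < c\<close> B(1) by simp
  ultimately have "eventually (\<lambda>x. A * (ln ^^ k) x powr - (\<epsilon> - \<nu>) < c * B powr - \<nu>) at_top"
    by (rule order_tendstoD)
  with eventually_iter_ln_ge_1[of k]
  have "eventually (\<lambda>x. x \<in> iter_ln_ge_1 k \<and> A * (ln ^^ k) x powr - (\<epsilon> - \<nu>) < c * B powr - \<nu>) at_top"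
    by (rule eventually_conj)
  then have ev: "eventually (\<lambda>\<zeta>. Re \<zeta> \<in> iter_ln_ge_1 k \<and>
      A * (ln ^^ k) (Re \<zeta>) powr - (\<epsilon> - \<nu>) < c * B powr - \<nu>) (Re_at_top_within U)"
    using filterlim_going_toI_weak unfolding filterlim_iff by blast
  have inU: "eventually (\<lambda>\<zeta>. \<zeta> \<in> U) (Re_at_top_within U)"
    by (simp add: eventually_going_to_at_top_linorder)
  from ev sector inU
  show "eventually (\<lambda>\<zeta>. norm (h \<zeta>) \<le> c * norm (iter_log k \<zeta> powr (- complex_of_real \<nu>)))
          (Re_at_top_within U)"
  proof eventually_elim
    case (elim \<zeta>)
    define l where "l = (ln ^^ k) (Re \<zeta>)"
    have l: "1 \<le> l" using elim by (simp add: l_def iter_ln_ge_1_def)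
    have le: "cmod (iter_log k \<zeta>) \<le> B * l" using B(2) elim by (simp add: l_def)
    have "l \<le> cmod (iter_log k \<zeta>)"
      using iter_ln_le_Re_iter_log[of \<zeta> k k] complex_Re_le_cmod[of "iter_log k \<zeta>"] elim
      by (simp add: l_def)
    then have pos: "0 < cmod (iter_log k \<zeta>)" using l by linarith
    have "cmod (h \<zeta>) \<le> A * l powr - \<epsilon>" using bound elim by (simp add: l_def)
    also have "l powr - \<epsilon> = l powr - (\<epsilon> - \<nu>) * l powr - \<nu>"
      by (simp flip: powr_add)
    also have "A * (l powr - (\<epsilon> - \<nu>) * l powr - \<nu>) = (A * l powr - (\<epsilon> - \<nu>)) * l powr - \<nu>"
      by simp
    also have "\<dots> \<le> (c * B powr - \<nu>) * l powr - \<nu>"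
      using elim by (intro mult_right_mono) (auto simp: l_def)
    also have "\<dots> = c * (B * l) powr - \<nu>"
      using B(1) l by (simp add: powr_mult)
    also have "\<dots> \<le> c * cmod (iter_log k \<zeta>) powr - \<nu>"
      using le pos \<open>0 < c\<close> assms(3) by (intro mult_left_mono powr_mono2') auto
    also have "cmod (iter_log k \<zeta>) powr - \<nu> = cmod (iter_log k \<zeta> powr (- complex_of_real \<nu>))"
      by (simp add: norm_powr_real_powr')
    finally show ?case by simp
  qed
qed

lemma strip_domain_in_sector:
  assumes "hl \<in> O[at_top](\<lambda>x. x)" "hu \<in> O[at_top](\<lambda>x. x)"
  shows "\<exists>K>0. eventually (\<lambda>\<zeta>. cmod \<zeta> \<le> K * Re \<zeta>) (Re_at_top_within (strip_domain t hl hu))"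
proof -
  obtain c1 where c1: "0 < c1" "eventually (\<lambda>x. norm (hl x) \<le> c1 * norm x) at_top"
    using assms(1) by (rule landau_o.bigE)
  obtain c2 where c2: "0 < c2" "eventually (\<lambda>x. norm (hu x) \<le> c2 * norm x) at_top"
    using assms(2) by (rule landau_o.bigE)
  obtain X where X: "\<And>x. X \<le> x \<Longrightarrow> norm (hl x) \<le> c1 * norm x \<and> norm (hu x) \<le> c2 * norm x"
    using eventually_conj[OF c1(2) c2(2)] unfolding eventually_at_top_linorder by blast
  have "cmod \<zeta> \<le> (1 + c1 + c2) * Re \<zeta>"
    if "\<zeta> \<in> strip_domain t hl hu" "X \<le> Re \<zeta>" for \<zeta>
  proof -
    have \<zeta>: "0 < Re \<zeta>" "hl (Re \<zeta>) < Im \<zeta>" "Im \<zeta> < hu (Re \<zeta>)"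
      using that(1) by (auto simp: strip_domain_def right_half_plane_def)
    have "0 \<le> c1 * Re \<zeta>" "0 \<le> c2 * Re \<zeta>" using c1(1) c2(1) \<zeta>(1) by auto
    then have "\<bar>Im \<zeta>\<bar> \<le> c1 * Re \<zeta> + c2 * Re \<zeta>" using X[OF that(2)] \<zeta> by auto
    then show ?thesis using cmod_le[of \<zeta>] \<zeta>(1) by (simp add: algebra_simps)
  qed
  then show ?thesis
    using c1(1) c2(1) unfolding eventually_going_to_at_top_linorder
    by (intro exI[of _ "1 + c1 + c2"]) auto
qed

text \<open>
  Far to the right, the error of \<open>f\<close> is at most the scale and also at most \<open>Re \<beta> / 2\<close>, the scale
  being at most 1 there. Hence half of \<open>Re \<beta>\<close> remains as the guaranteed advance of real parts, and
  cutting an invariant set at \<open>Re \<zeta> \<ge> R\<close> leaves it invariant.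
\<close>

lemma near_translation_Re_ge_part:
  assumes "0 < Re \<beta>" "0 < \<epsilon>" "R \<in> iter_ln_ge_1 k" "f ` M \<subseteq> M"
    and small: "\<And>\<zeta>. \<zeta> \<in> M \<Longrightarrow> R \<le> Re \<zeta> \<Longrightarrow>
       cmod (f \<zeta> - (\<zeta> + \<beta>)) \<le> min 1 (Re \<beta> / 2) * cmod (clog_scale \<epsilon> k \<zeta>)"
  shows "near_translation f \<beta> (Re_ge_part M R) (Re \<beta> / 2) R (log_scale \<epsilon> k)
           (\<lambda>x. (1 + 1 / (Re \<beta> / 2 * \<epsilon>)) * (ln ^^ k) x powr - \<epsilon>)"
proof -
  have reg: "x \<in> iter_ln_ge_1 k" if "R \<le> x" for x
    using iter_ln_ge_1_upward[OF assms(3) that] .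
  have dev: "cmod (f \<zeta> - (\<zeta> + \<beta>)) \<le> min 1 (Re \<beta> / 2) * log_scale \<epsilon> k (Re \<zeta>)"
    if "\<zeta> \<in> Re_ge_part M R" for \<zeta>
  proof -
    have \<zeta>: "\<zeta> \<in> M" "R \<le> Re \<zeta>" using that by (auto simp: Re_ge_part_def)
    have "min 1 (Re \<beta> / 2) * cmod (clog_scale \<epsilon> k \<zeta>)
            \<le> min 1 (Re \<beta> / 2) * log_scale \<epsilon> k (Re \<zeta>)"
      using norm_clog_scale_le[OF reg assms(2)] \<zeta>(2) assms(1) by (intro mult_left_mono) auto
    then show ?thesis using small[OF \<zeta>] by linarith
  qed
  have adv: "Re \<zeta> + Re \<beta> / 2 \<le> Re (f \<zeta>)" if "\<zeta> \<in> Re_ge_part M R" for \<zeta>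
  proof -
    have "R \<le> Re \<zeta>" using that by (simp add: Re_ge_part_def)
    then have s: "0 < log_scale \<epsilon> k (Re \<zeta>)" "log_scale \<epsilon> k (Re \<zeta>) \<le> 1"
      using reg assms(2) log_scale_pos log_scale_le_1 by blast+
    have "min 1 (Re \<beta> / 2) * log_scale \<epsilon> k (Re \<zeta>) \<le> Re \<beta> / 2 * 1"
      using s assms(1) by (intro mult_mono) auto
    then have "\<bar>Re (f \<zeta> - (\<zeta> + \<beta>))\<bar> \<le> Re \<beta> / 2"
      using dev[OF that] abs_Re_le_cmod[of "f \<zeta> - (\<zeta> + \<beta>)"] by linarith
    then show ?thesis unfolding minus_complex.sel plus_complex.sel by linarith
  qed
  show ?thesis
  proof
    show "f ` Re_ge_part M R \<subseteq> Re_ge_part M R"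
    proof safe
      fix \<zeta> assume z: "\<zeta> \<in> Re_ge_part M R"
      then show "f \<zeta> \<in> Re_ge_part M R"
        using adv[OF z] assms(1,4) by (auto simp: Re_ge_part_def)
    qed
    show "cmod (f \<zeta> - (\<zeta> + \<beta>)) \<le> log_scale \<epsilon> k (Re \<zeta>)" if "\<zeta> \<in> Re_ge_part M R" for \<zeta>
    proof -
      have "0 \<le> log_scale \<epsilon> k (Re \<zeta>)"
        using that reg log_scale_pos[of "Re \<zeta>" k \<epsilon>] by (force simp: Re_ge_part_def)
      then have "min 1 (Re \<beta> / 2) * log_scale \<epsilon> k (Re \<zeta>) \<le> 1 * log_scale \<epsilon> k (Re \<zeta>)"
        by (intro mult_right_mono) auto
      then show ?thesis using dev[OF that] by linarith
    qed
    show "0 \<le> log_scale \<epsilon> k x" if "R \<le> x" for x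
      using log_scale_pos[OF reg[OF that]] by (rule less_imp_le)
    show "log_scale \<epsilon> k y \<le> log_scale \<epsilon> k x" if "R \<le> x" "x \<le> y" for x y
      using log_scale_antimono[OF reg[OF that(1)] that(2) assms(2)] .
    show "(\<Sum>i<n. log_scale \<epsilon> k (x + real i * (Re \<beta> / 2)))
        \<le> (1 + 1 / (Re \<beta> / 2 * \<epsilon>)) * (ln ^^ k) x powr - \<epsilon>" if "R \<le> x" for x n
      using assms(1) by (intro sum_log_scale_le[OF reg[OF that] assms(2)]) simp
  qed (use adv assms(1) in \<open>auto simp: Re_ge_part_def\<close>)
qed

theorem theoremA:
  fixes \<beta> :: complex and \<epsilon> C :: real and k :: nat
    and D :: "complex set" and f :: "complex \<Rightarrow> complex"
  assumes "\<beta> \<in> right_half_plane" and "0 < \<epsilon>"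
    and "D \<subseteq> right_half_plane" and "admissible_domain \<beta> \<epsilon> k D"
    and "iter_exp0 k < C"
    and "analytic_map_on (Re_ge_part D C) f"
    and "(\<lambda>\<zeta>. f \<zeta> - (\<zeta> + \<beta>)) \<in> o[Re_at_top_within (Re_ge_part D C)](clog_scale \<epsilon> k)"
  defines "Df \<equiv> Re_ge_part (max_invariant f (Re_ge_part D C) D)"
  shows "\<exists>R0 > iter_exp0 k. \<forall>R \<ge> R0. \<exists>\<phi>.
    (invariant_set f (Re_ge_part D C) (Df R) \<and>
     linearization_on f \<beta> (Df R) \<phi> \<and>
     uniform_limit (Df R) (\<lambda>n \<zeta>. (f ^^ n) \<zeta> - of_nat n * \<beta>) \<phi> sequentially)
    \<and>
    (invariant_set f (Re_ge_part D C) (Df R \<inter> positive_axis) \<longrightarrow>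
       maps_into_positive_axis \<phi> (Df R \<inter> positive_axis))
    \<and>
    ((\<lambda>\<zeta>. \<phi> \<zeta> - \<zeta>) \<in> o[Re_at_top_within (Df R)](\<lambda>_. 1) \<and>
     (\<forall>\<nu> t hl hu. 0 < \<nu> \<and> \<nu> < \<epsilon> \<and> lower_upper_pair \<beta> \<epsilon> k t hl hu \<and>
        strip_domain t hl hu \<subseteq> Df R \<and>
        hl \<in> O[at_top](\<lambda>x. x) \<and> hu \<in> O[at_top](\<lambda>x. x) \<longrightarrow>
        (\<lambda>\<zeta>. \<phi> \<zeta> - \<zeta>) \<in>
          o[Re_at_top_within (strip_domain t hl hu)](\<lambda>\<zeta>. iter_log k \<zeta> powr (- complex_of_real \<nu>))))
    \<and>
    (\<forall>D1 \<psi>. D1 \<subseteq> D \<and> invariant_set f (Re_ge_part D C) D1 \<and>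
        linearization_on f \<beta> D1 \<psi> \<and>
        (\<lambda>\<zeta>. \<psi> \<zeta> - \<zeta>) \<in> o[Re_at_top_within D1](\<lambda>_. 1) \<longrightarrow>
        (\<forall>\<zeta> \<in> Re_ge_part D1 R. \<psi> \<zeta> = \<phi> \<zeta>))"
proof -
  define E where "E = Re_ge_part D C"
  define M where "M = max_invariant f E D"
  define A where "A = 1 + 1 / (Re \<beta> / 2 * \<epsilon>)"
  have \<beta>: "0 < Re \<beta>" using assms(1) by (simp add: right_half_plane_def)
  have A: "0 < A" using \<beta> assms(2) by (simp add: A_def add_pos_pos)
  have Df: "Df R = Re_ge_part M R" for R by (simp add: Df_def M_def E_def)
  have "invariant_set f E M" unfolding M_def by (rule max_invariant_invariant)
  then have M: "M \<subseteq> E" "f ` M \<subseteq> M" by (auto simp: invariant_set_def)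
  have cont: "continuous_on E f" and hol: "f holomorphic_on interior E"
    using assms(6) by (auto simp: analytic_map_on_def E_def)
  have "0 < min 1 (Re \<beta> / 2)" using \<beta> by simp
  from landau_o.smallD[OF assms(7) this]
  obtain X where X: "\<And>\<zeta>. \<zeta> \<in> E \<Longrightarrow> X \<le> Re \<zeta> \<Longrightarrow>
      cmod (f \<zeta> - (\<zeta> + \<beta>)) \<le> min 1 (Re \<beta> / 2) * cmod (clog_scale \<epsilon> k \<zeta>)"
    unfolding eventually_going_to_at_top_linorder E_def by auto
  obtain Y where Y: "Y \<in> iter_ln_ge_1 k"
    using eventually_happens[OF eventually_iter_ln_ge_1[of k]] by auto
  \<comment> \<open>Beyond \<open>X\<close> the error is small, beyond \<open>Y\<close> the logarithms are at least 1, and \<open>R0 > A\<close> makes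
    the linearization have positive real part.\<close>
  define R0 where "R0 = Max {X, Y, A + 1, iter_exp0 k + 1}"
  have R0: "X \<le> R0" "Y \<le> R0" "A < R0" "iter_exp0 k < R0"
    by (auto simp: R0_def less_max_iff_disj)
  show ?thesis
  proof (rule exI[of _ R0], intro conjI allI impI R0(4), goal_cases)
    case (1 R)
    then have R: "R0 \<le> R" .
    have reg: "x \<in> iter_ln_ge_1 k" if "R \<le> x" for x
      using iter_ln_ge_1_upward[OF Y] that R R0(2) by simp
    interpret near_translation f \<beta> "Df R" "Re \<beta> / 2" R "log_scale \<epsilon> k"
      "\<lambda>x. A * (ln ^^ k) x powr - \<epsilon>"
      unfolding Df A_def
    proof (rule near_translation_Re_ge_part[OF \<beta> assms(2) reg[OF order_refl] M(2)])
      fix \<zeta> assume "\<zeta> \<in> M" "R \<le> Re \<zeta>"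
      then show "cmod (f \<zeta> - (\<zeta> + \<beta>)) \<le> min 1 (Re \<beta> / 2) * cmod (clog_scale \<epsilon> k \<zeta>)"
        using X[of \<zeta>] M(1) R R0(1) by auto
    qed
    have sub: "Df R \<subseteq> E" using M(1) by (auto simp: Df Re_ge_part_def)
    have analytic: "analytic_map_on (Df R) koenigs_limit"
      by (intro koenigs_limit_analytic continuous_on_subset[OF cont sub]
        holomorphic_on_subset[OF hol interior_mono[OF sub]])
    have near: "cmod (koenigs_limit \<zeta> - \<zeta>) \<le> A * (ln ^^ k) (Re \<zeta>) powr - \<epsilon>"
      if "\<zeta> \<in> Df R" for \<zeta>
      using koenigs_limit_near_id[OF that] .
    have pos: "0 < Re (koenigs_limit \<zeta>)" if "\<zeta> \<in> Df R" for \<zeta>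
    proof -
      have "1 \<le> (ln ^^ k) (Re \<zeta>)"
        using reg[OF Re_ge[OF that]] by (simp add: iter_ln_ge_1_def)
      then have "(ln ^^ k) (Re \<zeta>) powr - \<epsilon> \<le> (ln ^^ k) (Re \<zeta>) powr 0"
        using assms(2) by (intro powr_mono) auto
      then have "A * (ln ^^ k) (Re \<zeta>) powr - \<epsilon> \<le> A * 1"
        using A \<open>1 \<le> _\<close> by (intro mult_left_mono) auto
      then have "\<bar>Re (koenigs_limit \<zeta> - \<zeta>)\<bar> \<le> A"
        using near[OF that] abs_Re_le_cmod[of "koenigs_limit \<zeta> - \<zeta>"] by linarith
      then show ?thesis using Re_ge[OF that] R R0(3) by (simp add: abs_le_iff)
    qed
    have small: "(\<lambda>\<zeta>. koenigs_limit \<zeta> - \<zeta>) \<in> o[Re_at_top_within (Df R)](\<lambda>_. 1)"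
    proof (rule smalloI_tendsto)
      have "((\<lambda>x. A * (ln ^^ k) x powr - \<epsilon>) \<longlongrightarrow> A * 0) at_top"
        using assms(2) by (intro tendsto_mult tendsto_const powr_iter_ln_tendsto_0)
      then have "((\<lambda>\<zeta>. A * (ln ^^ k) (Re \<zeta>) powr - \<epsilon>) \<longlongrightarrow> 0) (Re_at_top_within (Df R))"
        using filterlim_compose[OF _ filterlim_going_toI_weak] by force
      moreover have "eventually (\<lambda>\<zeta>. norm (koenigs_limit \<zeta> - \<zeta>) \<le> A * (ln ^^ k) (Re \<zeta>) powr - \<epsilon>)
          (Re_at_top_within (Df R))"
        using near by (auto simp: eventually_going_to_at_top_linorder)
      ultimately show "((\<lambda>\<zeta>. (koenigs_limit \<zeta> - \<zeta>) / 1) \<longlongrightarrow> 0) (Re_at_top_within (Df R))"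
        by (auto intro: Lim_null_comparison)
    qed simp
    have sector: "(\<lambda>\<zeta>. koenigs_limit \<zeta> - \<zeta>) \<in>
        o[Re_at_top_within (strip_domain t hl hu)](\<lambda>\<zeta>. iter_log k \<zeta> powr (- complex_of_real \<nu>))"
      if h: "0 < \<nu> \<and> \<nu> < \<epsilon> \<and> lower_upper_pair \<beta> \<epsilon> k t hl hu \<and> strip_domain t hl hu \<subseteq> Df R \<and>
        hl \<in> O[at_top](\<lambda>x. x) \<and> hu \<in> O[at_top](\<lambda>x. x)" for \<nu> t hl hu
    proof -
      obtain K where "0 < K"
        "eventually (\<lambda>\<zeta>. cmod \<zeta> \<le> K * Re \<zeta>) (Re_at_top_within (strip_domain t hl hu))"
        using strip_domain_in_sector h by blast
      then show ?thesis
        using h near by (intro smallo_iter_log_powr[where A = A and \<epsilon> = \<epsilon> and K = K]) auto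
    qed
    have axis: "maps_into_positive_axis koenigs_limit (Df R \<inter> positive_axis)"
      if inv_axis: "invariant_set f (Re_ge_part D C) (Df R \<inter> positive_axis)"
    proof -
      have "Im (koenigs_limit \<zeta>) = 0" if "\<zeta> \<in> Df R \<inter> positive_axis" for \<zeta>
        using that inv_axis
        by (intro koenigs_limit_Im_zero[of "Df R \<inter> positive_axis"])
           (auto simp: invariant_set_def positive_axis_def)
      then show ?thesis
        using pos by (auto simp: maps_into_positive_axis_def positive_axis_def right_half_plane_def)
    qed
    have unique: "\<psi> \<zeta> = koenigs_limit \<zeta>"
      if h: "D1 \<subseteq> D" "invariant_set f E D1" "linearization_on f \<beta> D1 \<psi>"
        "(\<lambda>\<zeta>. \<psi> \<zeta> - \<zeta>) \<in> o[Re_at_top_within D1](\<lambda>_. 1)" and \<zeta>: "\<zeta> \<in> Re_ge_part D1 R"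
      for D1 \<psi> \<zeta>
    proof (rule koenigs_limit_unique[OF _ _ _ _ h(4)])
      show "\<zeta> \<in> Df R"
        using invariant_subset_max_invariant[OF h(1,2)] \<zeta> by (auto simp: Df M_def Re_ge_part_def)
    qed (use h \<zeta> in \<open>auto simp: Re_ge_part_def invariant_set_def linearization_on_def\<close>)
    have inv: "invariant_set f (Re_ge_part D C) (Df R)"
      using sub invariant by (simp add: invariant_set_def E_def)
    have lin: "linearization_on f \<beta> (Df R) koenigs_limit"
      using analytic koenigs_limit_linearizes by (simp add: linearization_on_def)
    have lim: "uniform_limit (Df R) (\<lambda>n \<zeta>. (f ^^ n) \<zeta> - of_nat n * \<beta>) koenigs_limit sequentially"
      using koenigs_uniform_limit unfolding koenigs_def .
    show ?case
    proof (rule exI[of _ koenigs_limit], intro conjI allI impI ballI, goal_cases)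
      case 1 show ?case by (fact inv)
    next
      case 2 show ?case by (fact lin)
    next
      case 3 show ?case by (fact lim)
    next
      case 4 then show ?case by (rule axis)
    next
      case 5 show ?case by (fact small)
    next
      case 6 then show ?case by (rule sector)
    next
      case 7 then show ?case by (auto simp: E_def intro: unique)
    qed
  qed
qed

end
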